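(* Consider a binary-input finite-state intersymbol interference channel (FSISIC) with received sequence $\mathbf y=(y_1,\dots,y_N)$, and a binary linear code $\mathcal C$ of length $N$ with parity-check matrix $H$. Let $\mathbf g$ be the output of the LP joint decoder, i.e. of $$\operatorname*{arg\,min}_{\mathbf g\in\mathcal P_{\mathcal T}(H)}\sum_{i=1}^N\sum_{e\in\mathcal T_i}b_{i,e}g_{i,e}.$$ If $\mathbf g$ is integral (all $g_{i,e}\in\{0,1\}$), then the LP joint decoder outputs a joint ML codeword.
   Context: Finite-state channel: state set $\mathcal S$, inputs $x\in\{0,1\}$, outputs $y\in\mathcal Y$, transition law $P(y,s'\mid x,s)=\Pr(Y_i=y,S_i=s'\mid X_i=x,S_{i-1}=s)$ for all $i$, initial state distribution $P_0(s)=\Pr(S_0=s)$, and $P(y_1^N,s_1^N\mid x_1^N,s_0)=\prod_{i=1}^N P(y_i,s_i\mid x_i,s_{i-1})$. It is an FSISIC if the next state is a deterministic function $\eta(x,s)$ of the current state $s$ and input $x$, i.e. $\sum_{y\in\mathcal Y}P(y,s'\mid x,s)$ equals $1$ if $\eta(x,s)=s'$ and $0$ otherwise (an integral over $y$ for continuous outputs). Joint ML codeword: an output of the joint ML decoder for codewords, which computes $\operatorname*{arg\,max}_{x_1^N\in\mathcal C}\sum_{s_1^N\in\mathcal S^N}P(y_1^N,s_1^N\mid x_1^N,s_0)\,P_0(s_0)$, where $s_0$ is the initial state. The codeword associated with an integral $\mathbf g$ is $\mathcal Q(\mathbf g)$, defined below. Trellis: one trellis section has edge set $E=\{1,\dots,O\}$,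 with one edge for each input-labelled state transition. An edge $e$ has initial state $s(e)$, final state $s'(e)$ and input bit $x(e)$. $\mathcal T_i$ denotes the set of edges in the section at time $i\in\{1,\dots,N\}$. Branch metrics: $b_{i,e}=-\ln P(y_i,s'(e)\mid x(e),s(e))$ for $i>1$ and $b_{1,e}=-\ln[P(y_1,s'(e)\mid x(e),s(e))\,P_0(s(e))]$. Trellis polytope $\mathcal T$: the set of $\mathbf g\in[0,1]^{N\times O}$ such that $\sum_{e:s'(e)=k}g_{i,e}=\sum_{e:s(e)=k}g_{i+1,e}$ for all $i=1,\dots,N-1$ and $k\in\mathcal S$, and $\sum_{e\in\mathcal T_p}g_{p,e}=1$ for any $p\in\{1,\dots,N\}$. Code: $\mathcal C=\{\mathbf c\in\{0,1\}^N: \sum_{i\in L}c_i\equiv 0 \bmod 2\ \forall L\in\mathcal L\}$, where $\mathcal L$ is the collection of supports of the rows of $H$. Relaxed polytope: $\mathcal P(H)=\bigcap_{L\in\mathcal L}\mathrm{LCP}(L)$, with $\mathrm{LCP}(L)=\bigcap_{S\subseteq L,\,|S|\text{ odd}}\{\mathbf c\in[0,1]^N:\sum_{i\in S}c_i-\sum_{i\in L\setminus S}c_i\le |S|-1\}$. Projection: $\mathcal Q(\mathbf g)=(f_1,\dots,f_N)$ with $f_i=\sum_{e\in\mathcal T_i:\,x(e)=1}g_{i,e}$. Trellis-wise relaxed polytope: $\mathcal P_{\mathcal T}(H)=\{\mathbf g\in\mathcal T:\mathcal Q(\mathbf g)\in\mathcal P(H)\}$.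
   Formalization: Received symbols lie outside a fixed null set of outputs (empty for discrete outputs). The initial state in the ML rule is the known one if P_0 is a point mass, and otherwise the initial state of the trellis path g; the claim fails without these. *)

theory Defs
  imports "HOL-Probability.Probability" "HOL-Library.Z2"
begin

text \<open>
  \<open>P y s' x s\<close> stands for \<open>P(y, s' | x, s)\<close>.  The output alphabet is the space of a reference
  measure \<open>M\<close>, and \<open>P(\<cdot>, s' | x, s)\<close> is a density with respect to \<open>M\<close>: for
  \<open>M = count_space Y\<close> the integrals below are sums over a discrete alphabet \<open>Y\<close>; for
  \<open>M = lborel\<close> they are Lebesgue integrals over a continuous one.  Inputs are elements of
  the two-element field \<^typ>\<open>bit\<close>.
\<close>

type_synonym ('y, 's) transition_law = "'y \<Rightarrow> 's \<Rightarrow> bit \<Rightarrow> 's \<Rightarrow> real"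

definition next_state_prob ::
    "'y measure \<Rightarrow> ('y, 's) transition_law \<Rightarrow> 's \<Rightarrow> bit \<Rightarrow> 's \<Rightarrow> ennreal" where
  "next_state_prob M P s' x s = (\<integral>\<^sup>+ y. ennreal (P y s' x s) \<partial>M)"

definition finite_state_channel ::
    "'y measure \<Rightarrow> ('y, 's::finite) transition_law \<Rightarrow> bool" where
  "finite_state_channel M P \<longleftrightarrow>
     (\<forall>s' x s. (\<lambda>y. P y s' x s) \<in> borel_measurable M) \<and>
     (\<forall>y\<in>space M. \<forall>s' x s. 0 \<le> P y s' x s) \<and>
     (\<forall>x s. (\<Sum>s'\<in>UNIV. next_state_prob M P s' x s) = 1)"

text \<open>
  The condition constrains \<open>P\<close> only up to an \<open>M\<close>-null set of outputs: for \<open>s' \<noteq> \<eta> x s\<close> the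
  density \<open>P y s' x s\<close> may be positive at exceptional \<open>y\<close>.  There is no such \<open>y\<close> for a discrete
  alphabet, since \<open>null_sets (count_space Y) = {{}}\<close>.
\<close>

definition FSISIC :: "'y measure \<Rightarrow> ('y, 's::finite) transition_law \<Rightarrow> bool" where
  "FSISIC M P \<longleftrightarrow>
     finite_state_channel M P \<and>
     (\<exists>\<eta>. \<forall>s' x s. next_state_prob M P s' x s = (if \<eta> x s = s' then 1 else 0))"

text \<open>\<open>P(y\<^sub>1\<^sup>N, s\<^sub>1\<^sup>N | x\<^sub>1\<^sup>N, s\<^sub>0)\<close>; the sequences are indexed from \<open>1\<close> to \<open>N\<close>.\<close>

definition sequence_prob ::
    "('y, 's) transition_law \<Rightarrow> nat \<Rightarrow> (nat \<Rightarrow> 'y) \<Rightarrow> (nat \<Rightarrow> 's) \<Rightarrow> (nat \<Rightarrow> bit) \<Rightarrow> 's \<Rightarrow> real" where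
  "sequence_prob P N y s x s0 = (\<Prod>i=1..N. P (y i) (s i) (x i) (if i = 1 then s0 else s (i - 1)))"

text \<open>
  The parity-check matrix \<open>H\<close> has rows \<open>1..m\<close> and columns \<open>1..N\<close>.
  Vectors of length \<open>N\<close> are extensional functions on \<open>{1..N}\<close>.
\<close>

definition row_supports :: "nat \<Rightarrow> nat \<Rightarrow> (nat \<Rightarrow> nat \<Rightarrow> bit) \<Rightarrow> nat set set" where
  "row_supports m N H = (\<lambda>j. {i \<in> {1..N}. H j i = 1}) ` {1..m}"

text \<open>The sum is taken in \<^typ>\<open>bit\<close>, hence modulo 2.\<close>

definition code :: "nat \<Rightarrow> nat \<Rightarrow> (nat \<Rightarrow> nat \<Rightarrow> bit) \<Rightarrow> (nat \<Rightarrow> bit) set" where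
  "code m N H = {c \<in> {1..N} \<rightarrow>\<^sub>E UNIV. \<forall>L\<in>row_supports m N H. (\<Sum>i\<in>L. c i) = 0}"

definition LCP :: "nat \<Rightarrow> nat set \<Rightarrow> (nat \<Rightarrow> real) set" where
  "LCP N L = {c \<in> {1..N} \<rightarrow>\<^sub>E {0..1}. \<forall>S. S \<subseteq> L \<and> odd (card S) \<longrightarrow>
     (\<Sum>i\<in>S. c i) - (\<Sum>i\<in>L - S. c i) \<le> real (card S) - 1}"

text \<open>The explicit cube only matters when \<open>H\<close> has no rows.\<close>

definition relaxed_polytope :: "nat \<Rightarrow> nat \<Rightarrow> (nat \<Rightarrow> nat \<Rightarrow> bit) \<Rightarrow> (nat \<Rightarrow> real) set" where
  "relaxed_polytope m N H = ({1..N} \<rightarrow>\<^sub>E {0..1}) \<inter> (\<Inter>L\<in>row_supports m N H. LCP N L)"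

definition real_word :: "nat \<Rightarrow> (nat \<Rightarrow> bit) \<Rightarrow> nat \<Rightarrow> real" where
  "real_word N c = (\<lambda>i\<in>{1..N}. if c i = 1 then 1 else 0)"

record 's trellis =
  num_edges :: nat
  initial :: "nat \<Rightarrow> 's"
  final :: "nat \<Rightarrow> 's"
  input :: "nat \<Rightarrow> bit"

text \<open>Every section, at each time, has the same edge set.\<close>

definition edges :: "('s, 'z) trellis_scheme \<Rightarrow> nat set" where
  "edges T = {1..num_edges T}"

text \<open>One edge for each input-labelled state transition that the channel can make.\<close>

definition trellis_of_channel ::
    "'y measure \<Rightarrow> ('y, 's) transition_law \<Rightarrow> 's trellis \<Rightarrow> bool" where
  "trellis_of_channel M P T \<longleftrightarrow>
     bij_betw (\<lambda>e. (initial T e, input T e, final T e)) (edges T)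
       {(s, x, s'). next_state_prob M P s' x s \<noteq> 0}"

definition trellis_polytope :: "nat \<Rightarrow> 's trellis \<Rightarrow> (nat \<times> nat \<Rightarrow> real) set" where
  "trellis_polytope N T = {g \<in> ({1..N} \<times> edges T) \<rightarrow>\<^sub>E {0..1}.
     (\<forall>i\<in>{1..<N}. \<forall>k. (\<Sum>e | e \<in> edges T \<and> final T e = k. g (i, e)) =
                       (\<Sum>e | e \<in> edges T \<and> initial T e = k. g (i + 1, e))) \<and>
     (\<forall>p\<in>{1..N}. (\<Sum>e\<in>edges T. g (p, e)) = 1)}"

definition projection :: "nat \<Rightarrow> 's trellis \<Rightarrow> (nat \<times> nat \<Rightarrow> real) \<Rightarrow> nat \<Rightarrow> real" where
  "projection N T g = (\<lambda>i\<in>{1..N}. \<Sum>e | e \<in> edges T \<and> input T e = 1. g (i, e))"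

definition trellis_relaxed_polytope ::
    "nat \<Rightarrow> nat \<Rightarrow> (nat \<Rightarrow> nat \<Rightarrow> bit) \<Rightarrow> 's trellis \<Rightarrow> (nat \<times> nat \<Rightarrow> real) set" where
  "trellis_relaxed_polytope m N H T =
     {g \<in> trellis_polytope N T. projection N T g \<in> relaxed_polytope m N H}"

definition integral_point :: "nat \<Rightarrow> 's trellis \<Rightarrow> (nat \<times> nat \<Rightarrow> real) \<Rightarrow> bool" where
  "integral_point N T g \<longleftrightarrow> (\<forall>i\<in>{1..N}. \<forall>e\<in>edges T. g (i, e) \<in> {0, 1})"

text \<open>
  Branch metrics are extended reals, because the argument of the logarithm may vanish (whereas
  \<open>ln 0 = 0\<close> on the reals).  As \<open>\<infinity> * 0 = 0\<close> in \<^typ>\<open>ereal\<close>, an edge of infinite metric is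
  free precisely if it is not used.
\<close>

definition neg_ln :: "real \<Rightarrow> ereal" where
  "neg_ln p = (if p = 0 then \<infinity> else ereal (- ln p))"

definition branch_metric ::
    "('y, 's) transition_law \<Rightarrow> 's pmf \<Rightarrow> (nat \<Rightarrow> 'y) \<Rightarrow> 's trellis \<Rightarrow> nat \<Rightarrow> nat \<Rightarrow> ereal" where
  "branch_metric P P0 y T i e =
     (if i = 1 then neg_ln (P (y 1) (final T e) (input T e) (initial T e) * pmf P0 (initial T e))
      else neg_ln (P (y i) (final T e) (input T e) (initial T e)))"

definition lp_objective ::
    "('y, 's) transition_law \<Rightarrow> 's pmf \<Rightarrow> nat \<Rightarrow> (nat \<Rightarrow> 'y) \<Rightarrow> 's trellis \<Rightarrow> (nat \<times> nat \<Rightarrow> real) \<Rightarrow> ereal" where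
  "lp_objective P P0 N y T g =
     (\<Sum>i=1..N. \<Sum>e\<in>edges T. branch_metric P P0 y T i e * ereal (g (i, e)))"

definition lp_joint_decoder_output ::
    "('y, 's) transition_law \<Rightarrow> 's pmf \<Rightarrow> nat \<Rightarrow> nat \<Rightarrow> (nat \<Rightarrow> nat \<Rightarrow> bit) \<Rightarrow> (nat \<Rightarrow> 'y) \<Rightarrow>
     's trellis \<Rightarrow> (nat \<times> nat \<Rightarrow> real) \<Rightarrow> bool" where
  "lp_joint_decoder_output P P0 m N H y T g \<longleftrightarrow>
     is_arg_min (lp_objective P P0 N y T) (\<lambda>g. g \<in> trellis_relaxed_polytope m N H T) g"

text \<open>
  The initial state \<open>s0\<close> is a parameter: the decoder sums over the states at times \<open>1\<close> to \<open>N\<close> only.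
\<close>

definition joint_ml_codeword ::
    "('y, 's::finite) transition_law \<Rightarrow> 's pmf \<Rightarrow> nat \<Rightarrow> nat \<Rightarrow> (nat \<Rightarrow> nat \<Rightarrow> bit) \<Rightarrow> (nat \<Rightarrow> 'y) \<Rightarrow>
     's \<Rightarrow> (nat \<Rightarrow> bit) \<Rightarrow> bool" where
  "joint_ml_codeword P P0 m N H y s0 c \<longleftrightarrow>
     is_arg_max (\<lambda>x. \<Sum>s\<in>{1..N} \<rightarrow>\<^sub>E UNIV. sequence_prob P N y s x s0 * pmf P0 s0)
       (\<lambda>x. x \<in> code m N H) c"

end

theory Submission
  imports Defs
begin

text \<open>
  The integral points of the trellis polytope are the indicators of trellis paths, and on such an
  indicator the LP objective is the negative logarithm of the probability of the path.  For an
  FSISIC, outside a null set of outputs, an input word and an initial state determine a single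
  state sequence of positive probability; the decoder sum therefore collapses to one term, which is
  the probability of the path with that input word and that initial state.  A binary
  word lies in the relaxed polytope if and only if it is a codeword.  So the optimal path is at least
  as probable as the path of any other codeword from any initial state.
\<close>

section \<open>Integral points of the trellis polytope as trellis paths\<close>

definition trellis_path :: "nat \<Rightarrow> 's trellis \<Rightarrow> (nat \<Rightarrow> nat) \<Rightarrow> bool" where
  "trellis_path N T p \<longleftrightarrow> (\<forall>i\<in>{1..N}. p i \<in> edges T) \<and>
     (\<forall>i\<in>{1..<N}. final T (p i) = initial T (p (i + 1)))"

text \<open>Being restricted to the index set, the indicator is extensional, as membership in
  \<open>trellis_polytope\<close> demands; it does not depend on the values of \<open>p\<close>
  outside \<open>{1..N}\<close>.\<close>

definition path_point :: "nat \<Rightarrow> 's trellis \<Rightarrow> (nat \<Rightarrow> nat) \<Rightarrow> nat \<times> nat \<Rightarrow> real" where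
  "path_point N T p = (\<lambda>(i, e)\<in>{1..N} \<times> edges T. if e = p i then 1 else 0)"

lemma trellis_path_step:
  assumes "trellis_path N T p" "i \<in> {1..N}" "i \<noteq> 1"
  shows "final T (p (i - 1)) = initial T (p i)"
proof -
  have "i - 1 \<in> {1..<N}" "i - 1 + 1 = i"
    using assms(2,3) by auto
  then show ?thesis
    using assms(1) unfolding trellis_path_def by metis
qed

lemma finite_edges [simp]: "finite (edges T)"
  by (simp add: edges_def)

lemma path_point_apply:
  "i \<in> {1..N} \<Longrightarrow> e \<in> edges T \<Longrightarrow> path_point N T p (i, e) = (if e = p i then 1 else 0)"
  by (simp add: path_point_def)

lemma sum_path_point:
  assumes "trellis_path N T p" "i \<in> {1..N}"
  shows "(\<Sum>e | e \<in> edges T \<and> Q e. path_point N T p (i, e)) = (if Q (p i) then 1 else 0)"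
proof -
  have "(\<Sum>e | e \<in> edges T \<and> Q e. path_point N T p (i, e)) =
        (\<Sum>e | e \<in> edges T \<and> Q e. if e = p i then 1 else 0)"
    using assms by (intro sum.cong) (auto simp: path_point_apply)
  also have "\<dots> = (if Q (p i) then 1 else 0)"
    using assms by (subst sum.delta) (auto simp: trellis_path_def)
  finally show ?thesis .
qed

lemma path_point_in_trellis_polytope:
  assumes "trellis_path N T p"
  shows "path_point N T p \<in> trellis_polytope N T"
proof -
  have "path_point N T p \<in> ({1..N} \<times> edges T) \<rightarrow>\<^sub>E {0..1}"
    by (auto simp: path_point_def)
  moreover have "(\<Sum>e | e \<in> edges T \<and> final T e = k. path_point N T p (i, e)) =
      (\<Sum>e | e \<in> edges T \<and> initial T e = k. path_point N T p (i + 1, e))" if "i \<in> {1..<N}" for i k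
    using that assms by (auto simp: sum_path_point trellis_path_def)
  moreover have "(\<Sum>e\<in>edges T. path_point N T p (i, e)) = 1" if "i \<in> {1..N}" for i
    using sum_path_point[OF assms that, of "\<lambda>_. True"] by simp
  ultimately show ?thesis
    unfolding trellis_polytope_def by blast
qed

lemma projection_path_point:
  assumes "trellis_path N T p"
  shows "projection N T (path_point N T p) = real_word N (\<lambda>i. input T (p i))"
  using assms unfolding projection_def real_word_def by (auto intro!: restrict_ext simp: sum_path_point)

text \<open>Values in {0, 1} that sum to 1 over a section select exactly one edge at each time. Flow
  conservation then makes consecutive selected edges fit together.\<close>

lemma integral_point_is_path_point:
  assumes g: "g \<in> trellis_polytope N T" and int: "integral_point N T g"
  obtains p where "trellis_path N T p" "g = path_point N T p"
proof -
  have ext: "g \<in> extensional ({1..N} \<times> edges T)"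
    using g by (auto simp: trellis_polytope_def PiE_def)
  have one: "\<exists>e\<in>edges T. \<forall>d\<in>edges T. g (i, d) = (if d = e then 1 else 0)" if i: "i \<in> {1..N}" for i
  proof -
    let ?A = "{e \<in> edges T. g (i, e) = 1}"
    have val: "g (i, d) = (if d \<in> ?A then 1 else 0)" if "d \<in> edges T" for d
      using int i that by (auto simp: integral_point_def)
    have "(\<Sum>d\<in>edges T. g (i, d)) = (\<Sum>d\<in>edges T. if g (i, d) = 1 then 1 else 0)"
      using val by (intro sum.cong) auto
    also have "\<dots> = real (card ?A)"
      by (simp add: sum.If_cases Int_def)
    finally have "real (card ?A) = 1"
      using g i by (auto simp: trellis_polytope_def)
    then obtain e where "?A = {e}"
      by (auto simp: card_1_singleton_iff)
    then show ?thesis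
      using val by (intro bexI[of _ e]) auto
  qed
  then have "\<forall>i\<in>{1..N}. \<exists>e. e \<in> edges T \<and> (\<forall>d\<in>edges T. g (i, d) = (if d = e then 1 else 0))"
    by blast
  then obtain p where p: "\<And>i. i \<in> {1..N} \<Longrightarrow> p i \<in> edges T"
    "\<And>i d. i \<in> {1..N} \<Longrightarrow> d \<in> edges T \<Longrightarrow> g (i, d) = (if d = p i then 1 else 0)"
    by metis
  have sums: "(\<Sum>e | e \<in> edges T \<and> Q e. g (i, e)) = (if Q (p i) then 1 else 0)"
    if "i \<in> {1..N}" for i Q
  proof -
    have "(\<Sum>e | e \<in> edges T \<and> Q e. g (i, e)) =
          (\<Sum>e | e \<in> edges T \<and> Q e. if e = p i then 1 else 0)"
      using p that by (intro sum.cong) auto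
    also have "\<dots> = (if Q (p i) then 1 else 0)"
      using p that by (subst sum.delta) auto
    finally show ?thesis .
  qed
  have "final T (p i) = initial T (p (i + 1))" if "i \<in> {1..<N}" for i
  proof -
    \<comment> \<open>Flow conservation is read at the state where edge \<open>p i\<close> ends. The
      left sum is then 1, so the right sum cannot be 0, and \<open>p (i + 1)\<close> starts in that
      state.\<close>
    have "(\<Sum>e | e \<in> edges T \<and> final T e = final T (p i). g (i, e)) =
          (\<Sum>e | e \<in> edges T \<and> initial T e = final T (p i). g (i + 1, e))"
      using g that unfolding trellis_polytope_def by blast
    then show ?thesis
      using that by (auto simp: sums split: if_splits)
  qed
  then have "trellis_path N T p"
    using p by (auto simp: trellis_path_def)
  moreover have "g = path_point N T p"
  proof (rule extensionalityI[OF ext])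
    show "path_point N T p \<in> extensional ({1..N} \<times> edges T)"
      by (simp add: path_point_def)
  qed (auto simp: p path_point_apply)
  ultimately show thesis
    by (rule that)
qed

section \<open>Extended negative logarithms and the LP objective of a path\<close>

lemma neg_ln_mult:
  assumes "0 \<le> a" "0 \<le> b"
  shows "neg_ln (a * b) = neg_ln a + neg_ln b"
  using assms by (auto simp: neg_ln_def ln_mult)

lemma neg_ln_prod:
  assumes "\<And>i. i \<in> A \<Longrightarrow> 0 \<le> f i"
  shows "neg_ln (\<Prod>i\<in>A. f i) = (\<Sum>i\<in>A. neg_ln (f i))"
  using assms
proof (induction A rule: infinite_finite_induct)
  case (insert a A)
  then show ?case
    by (simp add: neg_ln_mult prod_nonneg)
qed (simp_all add: neg_ln_def)

lemma neg_ln_le_cancel: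
  assumes "0 \<le> a" "0 \<le> b" "neg_ln a \<le> neg_ln b"
  shows "b \<le> a"
  using assms by (auto simp: neg_ln_def split: if_splits)

text \<open>Edges off the path contribute nothing even if their metric is infinite, because infinity
  times 0 is 0 in \<open>ereal\<close>. The factor from \<open>P0\<close> enters through the metric
  at time 1, so a first section must exist: for \<open>N = 0\<close> the objective is the empty
  sum.\<close>

lemma lp_objective_path_point:
  assumes path: "trellis_path N T p" and N: "1 \<le> N"
    and nonneg: "\<And>i s' x s. i \<in> {1..N} \<Longrightarrow> 0 \<le> P (y i) s' x s"
  shows "lp_objective P P0 N y T (path_point N T p) =
    neg_ln (sequence_prob P N y (\<lambda>i. final T (p i)) (\<lambda>i. input T (p i)) (initial T (p 1))
      * pmf P0 (initial T (p 1)))"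
proof -
  \<comment> \<open>The initial probability is absorbed into the factor at time 1, mirroring
    \<open>branch_metric\<close>.\<close>
  define f where "f i = P (y i) (final T (p i)) (input T (p i)) (initial T (p i)) *
    (if i = 1 then pmf P0 (initial T (p i)) else 1)" for i
  have "(\<Sum>e\<in>edges T. branch_metric P P0 y T i e * ereal (path_point N T p (i, e))) = neg_ln (f i)"
    if i: "i \<in> {1..N}" for i
  proof -
    have "(\<Sum>e\<in>edges T. branch_metric P P0 y T i e * ereal (path_point N T p (i, e))) =
        (\<Sum>e\<in>edges T. if e = p i then branch_metric P P0 y T i e else 0)"
      using i by (intro sum.cong) (auto simp: path_point_apply)
    also have "\<dots> = branch_metric P P0 y T i (p i)"
      using path i by (simp add: trellis_path_def)
    also have "\<dots> = neg_ln (f i)"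
      by (simp add: branch_metric_def f_def)
    finally show ?thesis .
  qed
  then have "lp_objective P P0 N y T (path_point N T p) = (\<Sum>i=1..N. neg_ln (f i))"
    by (simp add: lp_objective_def)
  also have "\<dots> = neg_ln (\<Prod>i=1..N. f i)"
    by (rule neg_ln_prod[symmetric]) (simp add: f_def nonneg)
  also have "(\<Prod>i=1..N. f i) =
      (\<Prod>i=1..N. P (y i) (final T (p i)) (input T (p i)) (initial T (p i))) * pmf P0 (initial T (p 1))"
    using N by (simp add: f_def prod.distrib)
  also have "(\<Prod>i=1..N. P (y i) (final T (p i)) (input T (p i)) (initial T (p i))) =
      sequence_prob P N y (\<lambda>i. final T (p i)) (\<lambda>i. input T (p i)) (initial T (p 1))"
    unfolding sequence_prob_def
  proof (rule prod.cong)
    fix i assume i: "i \<in> {1..N}"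
    then have "final T (p (i - 1)) = initial T (p i)" if "i \<noteq> 1"
      using path that by (intro trellis_path_step)
    then show "P (y i) (final T (p i)) (input T (p i)) (initial T (p i)) =
        P (y i) (final T (p i)) (input T (p i)) (if i = 1 then initial T (p 1) else final T (p (i - 1)))"
      by simp
  qed simp
  finally show ?thesis .
qed

section \<open>Collapse of the decoder sum to one state sequence\<close>

lemma sum_sequence_prob_single:
  fixes P :: "('y, 's::finite) transition_law"
  assumes det: "\<And>i s'. i \<in> {1..N} \<Longrightarrow> s' \<noteq> s i \<Longrightarrow>
    P (y i) s' (x i) (if i = 1 then s0 else s (i - 1)) = 0"
  shows "(\<Sum>t\<in>{1..N} \<rightarrow>\<^sub>E UNIV. sequence_prob P N y t x s0) = sequence_prob P N y s x s0"
proof -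
  have "sequence_prob P N y t x s0 = 0"
    if t: "t \<in> {1..N} \<rightarrow>\<^sub>E UNIV" "t \<noteq> restrict s {1..N}" for t
  proof (rule ccontr)
    assume "sequence_prob P N y t x s0 \<noteq> 0"
    then have nz: "P (y i) (t i) (x i) (if i = 1 then s0 else t (i - 1)) \<noteq> 0" if "i \<in> {1..N}" for i
      using that by (auto simp: sequence_prob_def)
    \<comment> \<open>In a nonzero product no factor vanishes, so \<open>t\<close> must follow
      \<open>s\<close> step by step. The base case is vacuous as 0 is not a time; at time 1 the
      preceding state is \<open>s0\<close> for both sequences, which starts the induction.\<close>
    have "i \<in> {1..N} \<longrightarrow> t i = s i" for i
    proof (induction i)
      case (Suc i)
      then show ?case
        using nz[of "Suc i"] det[of "Suc i" "t (Suc i)"] by (cases "i = 0") auto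
    qed simp
    then have "t = restrict s {1..N}"
      using t(1) by (intro extensionalityI[of _ "{1..N}"]) (auto simp: PiE_def)
    with t(2) show False
      by simp
  qed
  then have "(\<Sum>t\<in>{1..N} \<rightarrow>\<^sub>E UNIV. sequence_prob P N y t x s0) =
      (\<Sum>t\<in>{restrict s {1..N}}. sequence_prob P N y t x s0)"
    by (intro sum.mono_neutral_right) (auto simp: finite_PiE)
  \<comment> \<open>Restricting \<open>s\<close> changes nothing: the factor at time 1 takes
    \<open>s0\<close> instead of \<open>s 0\<close>, so only times 1 to \<open>N\<close> are
    read.\<close>
  also have "\<dots> = sequence_prob P N y s x s0"
    by (auto simp: sequence_prob_def intro!: prod.cong)
  finally show ?thesis .
qed

lemma sequence_prob_cong_input:
  assumes "\<And>i. i \<in> {1..N} \<Longrightarrow> x i = x' i"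
  shows "sequence_prob P N y s x s0 = sequence_prob P N y s x' s0"
  using assms by (simp add: sequence_prob_def)

section \<open>Binary points of the relaxed polytope are the codewords\<close>

lemma sum_bit_eq_0_iff:
  fixes c :: "'a \<Rightarrow> bit"
  assumes "finite L"
  shows "(\<Sum>i\<in>L. c i) = 0 \<longleftrightarrow> even (card {i \<in> L. c i = 1})"
proof -
  have "(\<Sum>i\<in>L. c i) = (\<Sum>i\<in>L. if c i = 1 then 1 else 0)"
    by (rule sum.cong) auto
  also have "\<dots> = of_nat (card {i \<in> L. c i = 1})"
    using assms by (simp add: sum.If_cases Int_def)
  also have "(of_nat n :: bit) = 0 \<longleftrightarrow> even n" for n
    by (induction n) auto
  finally show ?thesis .
qed

text \<open>Let A be the set of ones of \<open>c\<close> in \<open>L\<close>. If |A| is odd, the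
  constraint for S = A reads |A| <= |A| - 1 and fails. Conversely, by integrality a violated
  constraint for S gives |A \<inter> S| - |A - S| >= |S|, which forces A = S and hence |A|
  odd.\<close>

lemma real_word_in_LCP_iff:
  assumes "L \<subseteq> {1..N}"
  shows "real_word N c \<in> LCP N L \<longleftrightarrow> (\<Sum>i\<in>L. c i) = 0"
proof -
  have fin: "finite L"
    using assms finite_subset by blast
  define A where "A = {i \<in> L. c i = 1}"
  have finA: "finite A"
    using fin by (simp add: A_def)
  have sums: "(\<Sum>i\<in>B. real_word N c i) = card (A \<inter> B)" if "B \<subseteq> L" for B
  proof -
    have "(\<Sum>i\<in>B. real_word N c i) = (\<Sum>i\<in>B. if i \<in> A then 1 else 0)"
      using that assms by (intro sum.cong) (auto simp: real_word_def A_def)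
    also have "\<dots> = card (A \<inter> B)"
      using finite_subset[OF that fin] by (simp add: sum.If_cases Int_def conj_commute)
    finally show ?thesis .
  qed
  have cube: "real_word N c \<in> {1..N} \<rightarrow>\<^sub>E {0..1}"
    by (auto simp: real_word_def)
  have LCP: "real_word N c \<in> LCP N L \<longleftrightarrow> (\<forall>S. S \<subseteq> L \<and> odd (card S) \<longrightarrow>
      real (card (A \<inter> S)) - real (card (A \<inter> (L - S))) \<le> real (card S) - 1)"
    unfolding LCP_def using cube by (auto simp: sums)
  show ?thesis
    unfolding LCP sum_bit_eq_0_iff[OF fin] A_def[symmetric]
  proof (intro iffI allI impI)
    assume *: "\<forall>S. S \<subseteq> L \<and> odd (card S) \<longrightarrow>
      real (card (A \<inter> S)) - real (card (A \<inter> (L - S))) \<le> real (card S) - 1"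
    have "A \<inter> (L - A) = {}" "A \<subseteq> L"
      by (auto simp: A_def)
    then show "even (card A)"
      using *[rule_format, of A] by (cases "even (card A)") auto
  next
    fix S assume even: "even (card A)" and S: "S \<subseteq> L \<and> odd (card S)"
    have finS: "finite S"
      using S fin finite_subset by blast
    show "real (card (A \<inter> S)) - real (card (A \<inter> (L - S))) \<le> real (card S) - 1"
    proof (rule ccontr)
      assume "\<not> ?thesis"
      then have gt: "card (A \<inter> S) + 1 > card S + card (A \<inter> (L - S))"
        by linarith
      have le: "card (A \<inter> S) \<le> card S"
        using finS by (intro card_mono) auto
      have "A \<inter> S = S"
        using gt le finS by (intro card_subset_eq) auto
      moreover have "A \<inter> (L - S) = {}"
      proof -
        have "card (A \<inter> (L - S)) = 0"
          using gt le by linarith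
        then show ?thesis
          using finA by simp
      qed
      ultimately have "A = S"
        by (auto simp: A_def)
      with even S show False
        by simp
    qed
  qed
qed

lemma real_word_in_relaxed_polytope_iff:
  "real_word N c \<in> relaxed_polytope m N H \<longleftrightarrow> restrict c {1..N} \<in> code m N H"
proof -
  have "real_word N c \<in> {1..N} \<rightarrow>\<^sub>E {0..1}"
    by (auto simp: real_word_def)
  moreover have sub: "L \<subseteq> {1..N}" if "L \<in> row_supports m N H" for L
    using that by (auto simp: row_supports_def)
  moreover have "(\<Sum>i\<in>L. restrict c {1..N} i) = (\<Sum>i\<in>L. c i)" if "L \<in> row_supports m N H" for L
    using sub[OF that] by (intro sum.cong) auto
  ultimately show ?thesis
    by (auto simp: relaxed_polytope_def code_def real_word_in_LCP_iff)
qed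

section \<open>Trellis paths with prescribed inputs and initial state\<close>

lemma exists_trellis_path:
  assumes "\<And>s x. \<exists>e\<in>edges T. initial T e = s \<and> input T e = x"
  obtains p where "trellis_path N T p" "initial T (p 1) = s0" "\<And>i. 1 \<le> i \<Longrightarrow> input T (p i) = x i"
proof -
  obtain b where b: "\<And>s x. b s x \<in> edges T" "\<And>s x. initial T (b s x) = s"
      "\<And>s x. input T (b s x) = x"
    using assms by metis
  \<comment> \<open>Edges are chosen from left to right. The value at 0 is a dummy, and the case
    split on \<open>i = 0\<close> makes the first real edge leave \<open>s0\<close> instead of the
    end of the dummy.\<close>
  define p where "p = rec_nat (b s0 (x 0)) (\<lambda>i e. b (if i = 0 then s0 else final T e) (x (Suc i)))"
  have p_Suc: "p (Suc i) = b (if i = 0 then s0 else final T (p i)) (x (Suc i))" for i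
    by (simp add: p_def)
  show thesis
  proof (rule that[of p])
    show "trellis_path N T p"
      unfolding trellis_path_def
    proof (intro conjI ballI)
      fix i assume "i \<in> {1..N}"
      then show "p i \<in> edges T"
        by (cases i) (auto simp: p_Suc b)
    qed (auto simp: p_Suc b)
    show "initial T (p 1) = s0"
      using p_Suc[of 0] by (simp add: b)
    show "input T (p i) = x i" if "1 \<le> i" for i
      using that by (cases i) (auto simp: p_Suc b)
  qed
qed

section \<open>Exceptional outputs of the channel\<close>

lemma UNIV_bit: "(UNIV :: bit set) = {0, 1}"
  using bit_not_zero_iff by auto

text \<open>A nonnegative density with integral 0 vanishes almost everywhere. There are only
  finitely many triples of next state, input and state, so the union of their exceptional sets is
  still null, and one set serves all of them.\<close>

lemma FSISIC_off_null_set: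
  fixes P :: "('y, 's::finite) transition_law"
  assumes "FSISIC M P"
  obtains Z where "Z \<in> null_sets M"
    "\<And>y s' x s. y \<in> space M - Z \<Longrightarrow> next_state_prob M P s' x s = 0 \<Longrightarrow> P y s' x s = 0"
proof -
  define I where "I = {(s', x, s). next_state_prob M P s' x s = 0}"
  define B where "B = (\<lambda>(s', x, s). {y \<in> space M. P y s' x s \<noteq> 0})"
  have "finite (UNIV :: bit set)"
    by (simp add: UNIV_bit)
  then have "finite (UNIV :: ('s \<times> bit \<times> 's) set)"
    by (simp add: finite_prod)
  then have "countable I"
    by (meson countable_finite finite_subset subset_UNIV)
  moreover have "B j \<in> null_sets M" if j: "j \<in> I" for j
  proof -
    obtain s' x s where [simp]: "j = (s', x, s)"
      by (cases j)
    have [measurable]: "(\<lambda>y. P y s' x s) \<in> borel_measurable M"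
      and nonneg: "\<And>y. y \<in> space M \<Longrightarrow> 0 \<le> P y s' x s"
      using assms by (auto simp: FSISIC_def finite_state_channel_def)
    have "AE y in M. ennreal (P y s' x s) = 0"
      using j by (subst nn_integral_0_iff_AE[symmetric]) (auto simp: I_def next_state_prob_def)
    then have "AE y in M. P y s' x s = 0"
      using AE_space by eventually_elim (use nonneg in force)
    moreover have "B j \<in> sets M"
      by (simp add: B_def)
    ultimately show ?thesis
      by (subst AE_iff_null_sets) (auto simp: B_def)
  qed
  ultimately have "(\<Union>j\<in>I. B j) \<in> null_sets M"
    by (rule null_sets_UN')
  then show thesis
    by (rule that) (auto simp: I_def B_def)
qed

section \<open>Optimality of the decoded codeword\<close>

theorem corollary14:
  fixes M :: "'y measure"
    and P :: "('y, 's::finite) transition_law"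
    and P0 :: "'s pmf"
    and T :: "'s trellis"
    and H :: "nat \<Rightarrow> nat \<Rightarrow> bit"
    and m N :: nat
  assumes "FSISIC M P"
    and "trellis_of_channel M P T"
  shows "\<exists>Z\<in>null_sets M. \<forall>y g.
     (\<forall>i\<in>{1..N}. y i \<in> space M - Z) \<and>
     lp_joint_decoder_output P P0 m N H y T g \<and> integral_point N T g \<longrightarrow>
     (\<exists>c. projection N T g = real_word N c \<and>
        (\<forall>s0. P0 = return_pmf s0 \<longrightarrow> joint_ml_codeword P P0 m N H y s0 c) \<and>
        (\<forall>e\<in>edges T. g (1, e) = 1 \<longrightarrow> joint_ml_codeword P P0 m N H y (initial T e) c))"
proof -
  obtain Z where Z: "Z \<in> null_sets M"
    "\<And>y s' x s. y \<in> space M - Z \<Longrightarrow> next_state_prob M P s' x s = 0 \<Longrightarrow> P y s' x s = 0"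
    using FSISIC_off_null_set[OF assms(1)] by blast
  obtain \<eta> where \<eta>: "\<And>s' x s. next_state_prob M P s' x s = (if \<eta> x s = s' then 1 else 0)"
    using assms(1) by (auto simp: FSISIC_def)
  have bij: "(\<lambda>e. (initial T e, input T e, final T e)) ` edges T = {(s, x, s'). \<eta> x s = s'}"
    using assms(2) by (auto simp: trellis_of_channel_def bij_betw_def \<eta>)
  have edge_final: "final T e = \<eta> (input T e) (initial T e)" if "e \<in> edges T" for e
    using bij that by blast
  \<comment> \<open>Since \<eta> is total, no state lacks an outgoing edge for either input; every
    word can therefore be driven through the trellis from every state.\<close>
  have edge_ex: "\<exists>e\<in>edges T. initial T e = s \<and> input T e = x" for s x
  proof -
    have "(s, x, \<eta> x s) \<in> (\<lambda>e. (initial T e, input T e, final T e)) ` edges T"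
      unfolding bij by simp
    then show ?thesis
      by auto
  qed
  show ?thesis
  proof (rule bexI[OF _ Z(1)], intro allI impI)
    fix y g
    assume A: "(\<forall>i\<in>{1..N}. y i \<in> space M - Z) \<and>
      lp_joint_decoder_output P P0 m N H y T g \<and> integral_point N T g"
    define W where "W x s0 = (\<Sum>s\<in>{1..N} \<rightarrow>\<^sub>E UNIV. sequence_prob P N y s x s0 * pmf P0 s0)" for x s0
    have nonneg: "0 \<le> P (y i) s' x s" if "i \<in> {1..N}" for i s' x s
      using assms(1) A that by (auto simp: FSISIC_def finite_state_channel_def)
    have W_nonneg: "0 \<le> W x s0" for x s0
      unfolding W_def sequence_prob_def
      by (intro sum_nonneg mult_nonneg_nonneg prod_nonneg) (auto simp: nonneg)
    \<comment> \<open>Avoiding \<open>Z\<close> turns the integral condition on the channel into a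
      pointwise one at the received outputs.\<close>
    have zero: "P (y i) s' x s = 0" if "i \<in> {1..N}" "s' \<noteq> \<eta> x s" for i s' x s
      using A that by (intro Z(2)) (auto simp: \<eta>)
    have g: "g \<in> trellis_polytope N T" "projection N T g \<in> relaxed_polytope m N H"
      using A by (auto simp: lp_joint_decoder_output_def is_arg_min_def trellis_relaxed_polytope_def)
    obtain p where p: "trellis_path N T p" "g = path_point N T p"
      using integral_point_is_path_point[OF g(1)] A by blast
    define c where "c = (\<lambda>i\<in>{1..N}. input T (p i))"
    have proj: "projection N T g = real_word N c"
      using p by (simp add: projection_path_point real_word_def c_def cong: restrict_cong)
    have c_code: "c \<in> code m N H"
      using g(2) p unfolding c_def by (simp add: projection_path_point real_word_in_relaxed_polytope_iff)
    \<comment> \<open>This links the two decoders: the LP cost of a path is the negative logarithm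
      of the joint ML score of its input word from its initial state. Agreement of \<open>x\<close>
      with the inputs is asked only on \<open>{1..N}\<close> because codewords are extensional
      there.\<close>
    have objective: "lp_objective P P0 N y T (path_point N T q) = neg_ln (W x (initial T (q 1)))"
      if N: "1 \<le> N" and q: "trellis_path N T q" and x: "\<And>i. i \<in> {1..N} \<Longrightarrow> x i = input T (q i)" for q x
    proof -
      have det: "P (y i) s' (x i) (if i = 1 then initial T (q 1) else final T (q (i - 1))) = 0"
        if i: "i \<in> {1..N}" and s': "s' \<noteq> final T (q i)" for i s'
      proof -
        have "final T (q (i - 1)) = initial T (q i)" if "i \<noteq> 1"
          using q that i by (intro trellis_path_step)
        moreover have "q i \<in> edges T"
          using q i by (auto simp: trellis_path_def)
        ultimately show ?thesis
          using i s' x by (auto intro!: zero simp: edge_final)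
      qed
      have "W x (initial T (q 1)) =
          sequence_prob P N y (\<lambda>i. final T (q i)) x (initial T (q 1)) * pmf P0 (initial T (q 1))"
        unfolding W_def sum_distrib_right[symmetric]
        by (intro arg_cong2[where f = "(*)"] refl sum_sequence_prob_single det)
      also have "sequence_prob P N y (\<lambda>i. final T (q i)) x (initial T (q 1)) =
          sequence_prob P N y (\<lambda>i. final T (q i)) (\<lambda>i. input T (q i)) (initial T (q 1))"
        by (rule sequence_prob_cong_input[OF x])
      finally show ?thesis
        using lp_objective_path_point[of N T q P y P0, OF q N nonneg] by simp
    qed
    \<comment> \<open>The two sides may have different initial states: the LP also chooses where the
      path starts, so the path of \<open>x\<close> from any \<open>s0\<close> is a feasible
      competitor.\<close>
    have best: "W x s0 \<le> W c (initial T (p 1))" if N: "1 \<le> N" and x: "x \<in> code m N H" for x s0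
    proof -
      obtain q where q: "trellis_path N T q" "initial T (q 1) = s0" "\<And>i. 1 \<le> i \<Longrightarrow> input T (q i) = x i"
        using exists_trellis_path[of T N s0 x] edge_ex by blast
      have "projection N T (path_point N T q) = real_word N x"
        using q by (auto simp: projection_path_point real_word_def intro!: restrict_ext)
      moreover have "restrict x {1..N} = x"
        using x by (auto simp: code_def intro: PiE_restrict)
      ultimately have "path_point N T q \<in> trellis_relaxed_polytope m N H T"
        using q(1) x
        by (simp add: trellis_relaxed_polytope_def path_point_in_trellis_polytope real_word_in_relaxed_polytope_iff)
      then have "lp_objective P P0 N y T g \<le> lp_objective P P0 N y T (path_point N T q)"
        using A by (auto simp: lp_joint_decoder_output_def is_arg_min_def not_less)
      moreover have "lp_objective P P0 N y T g = neg_ln (W c (initial T (p 1)))"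
        unfolding p(2) by (rule objective[OF N p(1)]) (simp add: c_def)
      moreover have "lp_objective P P0 N y T (path_point N T q) = neg_ln (W x s0)"
        unfolding q(2)[symmetric] by (rule objective[OF N q(1)]) (simp add: q(3))
      ultimately show ?thesis
        using neg_ln_le_cancel W_nonneg by metis
    qed
    have ml: "joint_ml_codeword P P0 m N H y s0 c"
      if "\<And>x. x \<in> code m N H \<Longrightarrow> W x s0 \<le> W c s0" for s0
      using that c_code unfolding joint_ml_codeword_def is_arg_max_def W_def by (auto simp: not_less)
    \<comment> \<open>For length 0 the only state sequence is the empty one and its probability is
      the empty product 1, so every word scores \<open>pmf P0 s0\<close>.\<close>
    have empty: "W x s0 = W c s0" if "N = 0" for x s0
      using that by (simp add: W_def sequence_prob_def)
    show "\<exists>c. projection N T g = real_word N c \<and>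
        (\<forall>s0. P0 = return_pmf s0 \<longrightarrow> joint_ml_codeword P P0 m N H y s0 c) \<and>
        (\<forall>e\<in>edges T. g (1, e) = 1 \<longrightarrow> joint_ml_codeword P P0 m N H y (initial T e) c)"
    proof (intro exI[of _ c] conjI allI ballI impI proj)
      fix s0 assume s0: "P0 = return_pmf s0"
      show "joint_ml_codeword P P0 m N H y s0 c"
      proof (rule ml)
        fix x assume x: "x \<in> code m N H"
        show "W x s0 \<le> W c s0"
        proof (cases "N = 0 \<or> initial T (p 1) = s0")
          case True
          then show ?thesis
            using empty[of x s0] best[OF _ x, of s0] by (cases "N = 0") auto
        next
          case False
          \<comment> \<open>The optimal path starts in a state of probability \<open>0\<close>, so all codewords tie at \<open>0\<close>.\<close>
          then have "W c (initial T (p 1)) = 0"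
            by (auto simp: W_def s0 indicator_def)
          then show ?thesis
            using False best[OF _ x, of s0] W_nonneg[of c s0] by simp
        qed
      qed
    next
      fix e assume e: "e \<in> edges T" "g (1, e) = 1"
      show "joint_ml_codeword P P0 m N H y (initial T e) c"
      proof (rule ml)
        fix x assume x: "x \<in> code m N H"
        show "W x (initial T e) \<le> W c (initial T e)"
        proof (cases "N = 0")
          case True
          then show ?thesis
            using empty[of x "initial T e"] by simp
        next
          case False
          \<comment> \<open>The edge with value 1 at time 1 is the first edge of the optimal path,
            so both initial states coincide and \<open>best\<close> applies directly.\<close>
          then have "e = p 1"
            using e p(2) by (auto simp: path_point_apply split: if_splits)
          with False show ?thesis
            using best[OF _ x] by simp
        qed
      qed
    qed
  qed
qed

end
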